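(* Let $V\ge 1$, $M\ge 1$, $W\ge 2$ and $1\le W_0\le W$ be integers, and suppose that each packet $p$ has work $w(p)\in\{W_0,W_0+1,\dots,W\}$ and profit $v(p)\in\{1,\dots,V\}$, that at most $M$ unknown packets may arrive in any cycle, and that traffic is non-uniform (i.e. not both $V=1$ and $W=W_0$). Then the competitive ratio of any randomized online algorithm is at least $$\frac{V(W-1)}{2W_0}\left[1-\left(1-\frac{1}{V(W-1)+1-W_0}\right)^{MW_0}\right],$$ even when compared against an optimal offline algorithm whose buffer can store only a single packet.
   Context: Model. Time is divided into discrete cycles, each consisting of three steps: (i) transmission: fully processed packets leave the queue; (ii) arrival: new packets may arrive, and the algorithm decides which of them to accept and which currently buffered packets to push out and drop; (iii) processing: the algorithm schedules a single buffered packet, which receives one processing cycle (processing of a packet may be interrupted and resumed). The online algorithm's buffer holds at most $B$ packets, $B\ge 2$. Packets have unit size; packet $p$ has a profit $v(p)$ (gained when it is transmitted) and a work $w(p)$ (the number of processing cycles it needs before it can be transmitted). On arrival the pair $(w(p),v(p))$ is either known to the algorithm (a $K$-packet) or unknown (a $U$-packet); the characteristics of a $U$-packet become known to the algorithm once the packet undergoes its first processing cycle (which counts as one of its $w(p)$ cycles). $M$ is the maximum number of $U$-packets arriving in a single cycle. The throughput of an algorithm on a finite arrival sequence is the total profit of all packets it eventually transmits. An online algorithm does not know future arrivals; an offline algorithm knows the whole arrival sequence, including the characteristics of all packets. A (randomized) online algorithm is $c$-competitive if for every finite arrival sequence the throughput of any offline algorithm is at most $c$ times the (expected) throughput of the online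 algorithm; its competitive ratio is the infimum of such $c$. *)

theory Defs
  imports "HOL-Probability.Probability" "HOL-Library.Extended_Nat"
begin

datatype packet = Packet (work: nat) (profit: nat) (known: bool)

(* One list of arriving packets per cycle; nothing arrives after the end of the list.
   A packet is identified by its arrival cycle and its position in the list of that cycle. *)
type_synonym arrivals = "packet list list"
type_synonym pid = "nat \<times> nat"

definition arriving :: "arrivals \<Rightarrow> nat \<Rightarrow> packet list" where
  "arriving \<sigma> t = (if t < length \<sigma> then \<sigma> ! t else [])"

definition arrival_ids :: "arrivals \<Rightarrow> nat \<Rightarrow> pid set" where
  "arrival_ids \<sigma> t = {(t, i) | i. i < length (arriving \<sigma> t)}"

definition packet_of :: "arrivals \<Rightarrow> pid \<Rightarrow> packet" where
  "packet_of \<sigma> p = arriving \<sigma> (fst p) ! snd p"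

definition traffic :: "nat \<Rightarrow> nat \<Rightarrow> nat \<Rightarrow> nat \<Rightarrow> arrivals set" where
  "traffic V W W\<^sub>0 M = {\<sigma>. \<forall>ps \<in> set \<sigma>.
     (\<forall>q \<in> set ps. work q \<in> {W\<^sub>0..W} \<and> profit q \<in> {1..V}) \<and>
     length (filter (\<lambda>q. \<not> known q) ps) \<le> M}"

(* The decision of a cycle: the packets in the buffer after the arrival step (all other
   candidates are rejected or pushed out), and the packet processed, if any. *)
type_synonym decision = "pid set \<times> pid option"
type_synonym schedule = "nat \<Rightarrow> decision"

abbreviation buffer :: "schedule \<Rightarrow> nat \<Rightarrow> pid set" where
  "buffer S t \<equiv> fst (S t)"

abbreviation processed :: "schedule \<Rightarrow> nat \<Rightarrow> pid option" where
  "processed S t \<equiv> snd (S t)"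

(* processing cycles received by p in the cycles before t *)
definition progress :: "schedule \<Rightarrow> nat \<Rightarrow> pid \<Rightarrow> nat" where
  "progress S t p = card {s. s < t \<and> processed S s = Some p}"

(* the buffer right after the transmission step of cycle t *)
fun retained :: "arrivals \<Rightarrow> schedule \<Rightarrow> nat \<Rightarrow> pid set" where
  "retained \<sigma> S 0 = {}"
| "retained \<sigma> S (Suc t) = {p \<in> buffer S t. progress S (Suc t) p < work (packet_of \<sigma> p)}"

(* Buffers are automatically finite here, so card is not misleading. *)
definition feasible :: "enat \<Rightarrow> arrivals \<Rightarrow> schedule \<Rightarrow> bool" where
  "feasible C \<sigma> S \<longleftrightarrow> (\<forall>t.
     buffer S t \<subseteq> retained \<sigma> S t \<union> arrival_ids \<sigma> t \<and>
     enat (card (buffer S t)) \<le> C \<and>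
     (\<forall>p. processed S t = Some p \<longrightarrow> p \<in> buffer S t))"

(* packets that leave in the transmission step of some cycle t + 1 *)
definition transmitted :: "arrivals \<Rightarrow> schedule \<Rightarrow> pid set" where
  "transmitted \<sigma> S = (\<Union>t. buffer S t - retained \<sigma> S (Suc t))"

definition throughput :: "arrivals \<Rightarrow> schedule \<Rightarrow> real" where
  "throughput \<sigma> S = (\<Sum>p \<in> transmitted \<sigma> S. real (profit (packet_of \<sigma> p)))"

(* Characteristics (work, profit), if available.  The observation of a cycle consists of
   those of the packets arriving in it, None standing for a U-packet, and those of the
   packet processed in the previous cycle, None meaning that no packet was processed. *)
type_synonym label = "(nat \<times> nat) option"
type_synonym observation = "label list \<times> label"

definition arrival_labels :: "arrivals \<Rightarrow> nat \<Rightarrow> label list" where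
  "arrival_labels \<sigma> t =
     map (\<lambda>q. if known q then Some (work q, profit q) else None) (arriving \<sigma> t)"

definition revealed :: "arrivals \<Rightarrow> pid option \<Rightarrow> label" where
  "revealed \<sigma> = map_option (\<lambda>p. (work (packet_of \<sigma> p), profit (packet_of \<sigma> p)))"

(* A deterministic online algorithm maps the observations of all cycles up to the current
   one, in chronological order, to the decision of the current cycle. *)
type_synonym algorithm = "observation list \<Rightarrow> decision"

primrec history :: "algorithm \<Rightarrow> arrivals \<Rightarrow> nat \<Rightarrow> observation list" where
  "history A \<sigma> 0 = [(arrival_labels \<sigma> 0, None)]"
| "history A \<sigma> (Suc t) = history A \<sigma> t @
     [(arrival_labels \<sigma> (Suc t), revealed \<sigma> (snd (A (history A \<sigma> t))))]"

definition run :: "algorithm \<Rightarrow> arrivals \<Rightarrow> schedule" where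
  "run A \<sigma> t = A (history A \<sigma> t)"

definition online_algorithm :: "arrivals set \<Rightarrow> nat \<Rightarrow> algorithm \<Rightarrow> bool" where
  "online_algorithm \<Sigma> B A \<longleftrightarrow> (\<forall>\<sigma> \<in> \<Sigma>. feasible (enat B) \<sigma> (run A \<sigma>))"

(* R is the probability space of random seeds. *)
definition randomized_online_algorithm ::
  "arrivals set \<Rightarrow> nat \<Rightarrow> 'r measure \<Rightarrow> ('r \<Rightarrow> algorithm) \<Rightarrow> bool" where
  "randomized_online_algorithm \<Sigma> B R A \<longleftrightarrow>
     prob_space R \<and>
     (\<forall>\<omega> \<in> space R. online_algorithm \<Sigma> B (A \<omega>)) \<and>
     (\<forall>\<sigma> \<in> \<Sigma>. (\<lambda>\<omega>. throughput \<sigma> (run (A \<omega>) \<sigma>)) \<in> borel_measurable R)"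

definition expected_throughput ::
  "'r measure \<Rightarrow> ('r \<Rightarrow> algorithm) \<Rightarrow> arrivals \<Rightarrow> real" where
  "expected_throughput R A \<sigma> = (\<integral>\<omega>. throughput \<sigma> (run (A \<omega>) \<sigma>) \<partial>R)"

(* C is the buffer capacity of the offline algorithm; an offline algorithm knows \<sigma>, so on
   each \<sigma> it may follow any feasible schedule. *)
definition competitive ::
  "arrivals set \<Rightarrow> enat \<Rightarrow> 'r measure \<Rightarrow> ('r \<Rightarrow> algorithm) \<Rightarrow> real \<Rightarrow> bool" where
  "competitive \<Sigma> C R A c \<longleftrightarrow>
     (\<forall>\<sigma> \<in> \<Sigma>. \<forall>S. feasible C \<sigma> S \<longrightarrow> throughput \<sigma> S \<le> c * expected_throughput R A \<sigma>)"

(* infinite if the algorithm is not c-competitive for any c *)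
definition competitive_ratio ::
  "arrivals set \<Rightarrow> enat \<Rightarrow> 'r measure \<Rightarrow> ('r \<Rightarrow> algorithm) \<Rightarrow> ereal" where
  "competitive_ratio \<Sigma> C R A = Inf {ereal c | c. competitive \<Sigma> C R A c}"

end

(* By averaging over a random instance it suffices to bound deterministic algorithms.
   In each of n cycles M unknown packets arrive, each independently good (work W0, profit V)
   with probability p = 1 / (V (W - 1) + 1 - W0) and bad (work W, profit 1) otherwise.

   Online: a packet x that receives X processing cycles gains at most (X + Z) / (W - 1), where
   Z = -1 if x is bad and Z = V (W - 1) - W0 if x is good, counted only if X > 0.  Whether x
   is ever opened does not depend on its type, and p is chosen such that E Z = 0.  Since the X
   sum up to at most n, the expected gain is at most n / (W - 1) + B V, where B V pays for the
   packets left in the buffer after the last arrival.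

   Offline: in each block of 2 W0 cycles, wait during the first half for a good packet, which
   exists with probability 1 - (1 - p)^(M W0) and can be completed within the block, even with
   a single buffer slot.  Now let the number of blocks tend to infinity. *)

theory Submission
  imports Defs
begin

section \<open>Feasible schedules\<close>

lemma finite_arrival_ids: "finite (\<Union>t. arrival_ids \<sigma> t)"
proof (rule finite_subset)
  show "(\<Union>t. arrival_ids \<sigma> t) \<subseteq> (SIGMA t : {..<length \<sigma>}. {..<length (arriving \<sigma> t)})"
    by (auto simp: arrival_ids_def arriving_def split: if_splits)
qed auto

lemma retained_subset_buffer: "retained \<sigma> S (Suc t) \<subseteq> buffer S t"
  by auto

lemma feasible_buffer_subset:
  assumes "feasible C \<sigma> S"
  shows "buffer S t \<subseteq> (\<Union>s. arrival_ids \<sigma> s)"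
proof (induction t)
  case 0
  show ?case using assms unfolding feasible_def by fastforce
next
  case (Suc t)
  have "buffer S (Suc t) \<subseteq> retained \<sigma> S (Suc t) \<union> arrival_ids \<sigma> (Suc t)"
    using assms unfolding feasible_def by blast
  then show ?case using Suc retained_subset_buffer[of \<sigma> S t] by blast
qed

lemma feasible_processed:
  assumes "feasible C \<sigma> S" "processed S t = Some p"
  shows "p \<in> (\<Union>s. arrival_ids \<sigma> s)"
proof -
  have "p \<in> buffer S t"
    using assms unfolding feasible_def by blast
  then show ?thesis
    using feasible_buffer_subset[OF assms(1)] by blast
qed

text \<open>Nothing arrives from cycle \<open>length \<sigma>\<close> on, so the buffer can only
  shrink. This lets late transmissions be charged to a single buffer content.\<close>

lemma feasible_buffer_antimono:
  assumes "feasible C \<sigma> S" "length \<sigma> \<le> s" "s \<le> t"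
  shows "buffer S t \<subseteq> buffer S s"
  using assms(3)
proof (induction t rule: dec_induct)
  case (step t)
  have "buffer S (Suc t) \<subseteq> retained \<sigma> S (Suc t) \<union> arrival_ids \<sigma> (Suc t)"
    using assms unfolding feasible_def by blast
  moreover have "arrival_ids \<sigma> (Suc t) = {}"
    using assms(2) step by (simp add: arrival_ids_def arriving_def)
  ultimately show ?case using step retained_subset_buffer[of \<sigma> S t] by blast
qed simp

lemma transmitted_subset:
  assumes "feasible C \<sigma> S"
  shows "transmitted \<sigma> S \<subseteq> (\<Union>t. arrival_ids \<sigma> t)"
  unfolding transmitted_def using feasible_buffer_subset[OF assms] by blast

lemma progress_mono: "s \<le> t \<Longrightarrow> progress S s p \<le> progress S t p"
  unfolding progress_def by (rule card_mono) auto

text \<open>A cycle processes at most one packet, so the sets of cycles spent on distinct packets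
  are disjoint.\<close>

lemma sum_progress_le:
  assumes "finite I"
  shows "(\<Sum>p\<in>I. progress S n p) \<le> n"
proof -
  have "(\<Sum>p\<in>I. progress S n p) = card (\<Union>p\<in>I. {s. s < n \<and> processed S s = Some p})"
    unfolding progress_def using assms by (subst card_UN_disjoint) auto
  also have "\<dots> \<le> card {..<n}"
    by (rule card_mono) auto
  finally show ?thesis by simp
qed

lemma transmitted_before_or_buffered:
  assumes "feasible C \<sigma> S"
  shows "transmitted \<sigma> S \<subseteq>
    buffer S (length \<sigma>) \<union> {p. work (packet_of \<sigma> p) \<le> progress S (length \<sigma>) p}"
proof
  fix p assume "p \<in> transmitted \<sigma> S"
  then obtain t where t: "p \<in> buffer S t" "work (packet_of \<sigma> p) \<le> progress S (Suc t) p"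
    unfolding transmitted_def by auto
  show "p \<in> buffer S (length \<sigma>) \<union> {p. work (packet_of \<sigma> p) \<le> progress S (length \<sigma>) p}"
  proof (cases "t < length \<sigma>")
    case True
    then show ?thesis
      using t progress_mono[of "Suc t" "length \<sigma>" S p] by auto
  next
    case False
    then show ?thesis
      using t feasible_buffer_antimono[OF assms, of "length \<sigma>" t] by auto
  qed
qed

text \<open>Packets transmitted late all sit in the buffer at cycle \<open>length \<sigma>\<close>,
  so at most \<open>B\<close> of them exist, each worth at most \<open>V\<close>. All others have
  received their full work by then.\<close>

lemma throughput_le:
  assumes feas: "feasible (enat B) \<sigma> S"
    and V: "\<And>p. p \<in> (\<Union>t. arrival_ids \<sigma> t) \<Longrightarrow> profit (packet_of \<sigma> p) \<le> V"
  shows "throughput \<sigma> S \<le> real B * real V +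
    (\<Sum>p\<in>(\<Union>t. arrival_ids \<sigma> t).
      if work (packet_of \<sigma> p) \<le> progress S (length \<sigma>) p then real (profit (packet_of \<sigma> p)) else 0)"
proof -
  let ?I = "\<Union>t. arrival_ids \<sigma> t" and ?b = "buffer S (length \<sigma>)"
  let ?D = "{p \<in> ?I. work (packet_of \<sigma> p) \<le> progress S (length \<sigma>) p}"
  let ?v = "\<lambda>p. real (profit (packet_of \<sigma> p))"
  have fin: "finite ?I" by (rule finite_arrival_ids)
  have b: "?b \<subseteq> ?I" by (rule feasible_buffer_subset[OF feas])
  have finb: "finite ?b" using fin b by (rule rev_finite_subset)
  have finD: "finite ?D" using fin by (rule rev_finite_subset) auto
  have card: "card ?b \<le> B" using feas unfolding feasible_def by simp
  have "throughput \<sigma> S \<le> (\<Sum>p\<in>?b \<union> ?D. ?v p)"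
    unfolding throughput_def
    using transmitted_before_or_buffered[OF feas] transmitted_subset[OF feas] finb finD
    by (intro sum_mono2) auto
  also have "\<dots> \<le> (\<Sum>p\<in>?b. ?v p) + (\<Sum>p\<in>?D. ?v p)"
  proof -
    have "0 \<le> (\<Sum>p\<in>?b \<inter> ?D. ?v p)" by (simp add: sum_nonneg)
    then show ?thesis using sum.union_inter[OF finb finD, of ?v] by linarith
  qed
  also have "(\<Sum>p\<in>?b. ?v p) \<le> real (card ?b) * real V"
    using V b by (intro sum_bounded_above of_nat_mono) blast
  also have "real (card ?b) * real V \<le> real B * real V"
    using card by (intro mult_right_mono) auto
  also have "(\<Sum>p\<in>?D. ?v p) =
      (\<Sum>p\<in>?I. if work (packet_of \<sigma> p) \<le> progress S (length \<sigma>) p then ?v p else 0)"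
    using fin by (rule sum.inter_filter)
  finally show ?thesis by simp
qed

section \<open>Arrivals of two kinds of packets\<close>

text \<open>Encoding an instance by the set \<open>G\<close> of ids of kind \<open>a\<close> turns a
  random instance into a random subset of a finite grid.\<close>

definition two_kinds :: "packet \<Rightarrow> packet \<Rightarrow> nat \<Rightarrow> nat \<Rightarrow> pid set \<Rightarrow> arrivals" where
  "two_kinds a b M n G =
     map (\<lambda>t. map (\<lambda>i. if (t, i) \<in> G then a else b) [0..<M]) [0..<n]"

lemma length_two_kinds [simp]: "length (two_kinds a b M n G) = n"
  by (simp add: two_kinds_def)

lemma arriving_two_kinds:
  "arriving (two_kinds a b M n G) t =
     (if t < n then map (\<lambda>i. if (t, i) \<in> G then a else b) [0..<M] else [])"
  by (simp add: two_kinds_def arriving_def)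

lemma arrival_ids_two_kinds:
  "arrival_ids (two_kinds a b M n G) t = (if t < n then {t} \<times> {..<M} else {})"
  by (auto simp: arrival_ids_def arriving_two_kinds)

lemma UN_arrival_ids_two_kinds:
  "(\<Union>t. arrival_ids (two_kinds a b M n G) t) = {..<n} \<times> {..<M}"
  by (auto simp: arrival_ids_two_kinds split: if_splits)

lemma packet_of_two_kinds:
  "p \<in> {..<n} \<times> {..<M} \<Longrightarrow> packet_of (two_kinds a b M n G) p = (if p \<in> G then a else b)"
  by (auto simp: packet_of_def arriving_two_kinds)

lemma two_kinds_in_traffic:
  assumes "work a \<in> {W\<^sub>0..W}" "profit a \<in> {1..V}" "work b \<in> {W\<^sub>0..W}" "profit b \<in> {1..V}"
  shows "two_kinds a b M n G \<in> traffic V W W\<^sub>0 M"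
proof -
  have "length (filter P (map f [0..<M])) \<le> M" for P :: "packet \<Rightarrow> bool" and f
    by (rule order.trans[OF length_filter_le]) simp
  then show ?thesis using assms by (auto simp: traffic_def two_kinds_def simp del: filter_map)
qed

lemma arrival_labels_two_kinds:
  assumes "\<not> known a" "\<not> known b"
  shows "arrival_labels (two_kinds a b M n G) t = (if t < n then replicate M None else [])"
  using assms by (intro nth_equalityI) (auto simp: arrival_labels_def arriving_two_kinds split: if_splits)

section \<open>Online algorithms on arrivals of two kinds\<close>

text \<open>All arrivals are unknown, so observations depend on \<open>G\<close> only through the
  packets processed. Two instances that differ at most in the kind of \<open>x\<close> thus look
  alike until \<open>x\<close> is opened.\<close>

lemma history_two_kinds_cong:
  assumes unk: "\<not> known a" "\<not> known b"
    and feas: "feasible C (two_kinds a b M n G) (run A (two_kinds a b M n G))"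
    and eq: "G - {x} = G' - {x}"
    and notx: "\<And>s. s < t \<Longrightarrow> processed (run A (two_kinds a b M n G)) s \<noteq> Some x"
  shows "history A (two_kinds a b M n G) t = history A (two_kinds a b M n G') t"
  using notx
proof (induction t)
  case 0
  show ?case by (simp add: arrival_labels_two_kinds[OF unk])
next
  case (Suc t)
  let ?\<sigma> = "two_kinds a b M n G" and ?\<sigma>' = "two_kinds a b M n G'"
  have IH: "history A ?\<sigma> t = history A ?\<sigma>' t"
    using Suc.prems by (intro Suc.IH) simp
  have "revealed ?\<sigma> (snd (A (history A ?\<sigma> t))) = revealed ?\<sigma>' (snd (A (history A ?\<sigma> t)))"
  proof (cases "snd (A (history A ?\<sigma> t))")
    case None
    then show ?thesis by (simp add: revealed_def)
  next
    case (Some p)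
    then have pr: "processed (run A ?\<sigma>) t = Some p" by (simp add: run_def)
    \<comment> \<open>Only inside the grid does membership in \<open>G\<close> determine
      \<open>packet_of\<close>; feasibility keeps the processed packet there.\<close>
    then have "p \<in> {..<n} \<times> {..<M}"
      using feasible_processed[OF feas] UN_arrival_ids_two_kinds by metis
    moreover have "p \<noteq> x" using pr Suc.prems[of t] by auto
    then have "p \<in> G \<longleftrightarrow> p \<in> G'" using eq by blast
    ultimately show ?thesis using Some by (simp add: revealed_def packet_of_two_kinds)
  qed
  then show ?case using IH by (simp add: arrival_labels_two_kinds[OF unk])
qed

lemma progress_eq_0_iff: "progress S t p = 0 \<longleftrightarrow> (\<forall>s<t. processed S s \<noteq> Some p)"
  unfolding progress_def by (subst card_0_eq) auto

text \<open>If \<open>x\<close> is never processed before \<open>t\<close> in one run, the histories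
  of both runs agree up to then, hence so do the decisions.\<close>

lemma opened_indep:
  assumes unk: "\<not> known a" "\<not> known b"
    and feas: "feasible C (two_kinds a b M n G) (run A (two_kinds a b M n G))"
    and feas': "feasible C (two_kinds a b M n G') (run A (two_kinds a b M n G'))"
    and eq: "G - {x} = G' - {x}"
  shows "progress (run A (two_kinds a b M n G)) t x = 0 \<longleftrightarrow>
    progress (run A (two_kinds a b M n G')) t x = 0"
proof -
  have *: "progress (run A (two_kinds a b M n G')) t x = 0"
    if f: "feasible C (two_kinds a b M n G) (run A (two_kinds a b M n G))"
      and e: "G - {x} = G' - {x}"
      and z: "progress (run A (two_kinds a b M n G)) t x = 0" for G G'
    unfolding progress_eq_0_iff
  proof (intro allI impI)
    fix s assume "s < t"
    then have "history A (two_kinds a b M n G) s = history A (two_kinds a b M n G') s"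
      using z by (intro history_two_kinds_cong[OF unk f e]) (auto simp: progress_eq_0_iff)
    then show "processed (run A (two_kinds a b M n G')) s \<noteq> Some x"
      using z \<open>s < t\<close> unfolding progress_eq_0_iff run_def by metis
  qed
  show ?thesis using *[OF feas eq] *[OF feas' eq[symmetric]] by blast
qed

section \<open>Random subsets\<close>

text \<open>For \<open>G\<close> inside \<open>I\<close>, the probability that independent coin
  flips with bias \<open>p\<close> select exactly \<open>G\<close>. Expectations become finite sums
  over \<open>Pow I\<close>.\<close>

definition subset_weight :: "real \<Rightarrow> 'a set \<Rightarrow> 'a set \<Rightarrow> real" where
  "subset_weight p I G = (\<Prod>x\<in>I. if x \<in> G then p else 1 - p)"

lemma subset_weight_nonneg: "0 \<le> p \<Longrightarrow> p \<le> 1 \<Longrightarrow> 0 \<le> subset_weight p I G"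
  unfolding subset_weight_def by (rule prod_nonneg) auto

lemma sum_Pow_insert:
  fixes f :: "'a set \<Rightarrow> real"
  assumes "finite I" "x \<notin> I"
  shows "(\<Sum>G\<in>Pow (insert x I). f G) = (\<Sum>G\<in>Pow I. f G + f (insert x G))"
proof -
  have "inj_on (insert x) (Pow I)"
    using assms(2) by (auto simp: inj_on_def)
  moreover have "Pow I \<inter> insert x ` Pow I = {}"
    using assms(2) by auto
  ultimately show ?thesis
    using assms(1) by (simp add: Pow_insert sum.union_disjoint sum.reindex sum.distrib)
qed

lemma subset_weight_insert:
  assumes "finite I" "x \<notin> I" "G \<subseteq> I"
  shows "subset_weight p (insert x I) G = (1 - p) * subset_weight p I G"
    and "subset_weight p (insert x I) (insert x G) = p * subset_weight p I G"
proof -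
  show "subset_weight p (insert x I) G = (1 - p) * subset_weight p I G"
    using assms by (auto simp: subset_weight_def)
  have "(\<Prod>y\<in>I. if y \<in> insert x G then p else 1 - p) = (\<Prod>y\<in>I. if y \<in> G then p else 1 - p)"
    using assms by (intro prod.cong) auto
  then show "subset_weight p (insert x I) (insert x G) = p * subset_weight p I G"
    using assms by (simp add: subset_weight_def)
qed

text \<open>By independence, each element of \<open>I\<close> in \<open>J\<close> contributes a
  factor 1 - p, any other one p + (1 - p) = 1.\<close>

lemma prob_avoid:
  assumes "finite I"
  shows "(\<Sum>G\<in>Pow I. subset_weight p I G * of_bool (G \<inter> J = {})) = (1 - p) ^ card (I \<inter> J)"
  using assms
proof (induction I)
  case empty
  show ?case by (simp add: subset_weight_def)
next
  case (insert x I)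
  have "(\<Sum>G\<in>Pow (insert x I). subset_weight p (insert x I) G * of_bool (G \<inter> J = {}))
      = (\<Sum>G\<in>Pow I. (1 - p) * (subset_weight p I G * of_bool (G \<inter> J = {})) +
          p * (subset_weight p I G * of_bool (G \<inter> J = {}) * of_bool (x \<notin> J)))"
    unfolding sum_Pow_insert[OF insert(1,2)]
    by (intro sum.cong) (auto simp: subset_weight_insert[OF insert(1,2)])
  also have "\<dots> = (1 - p + p * of_bool (x \<notin> J)) * (1 - p) ^ card (I \<inter> J)"
    unfolding sum.distrib sum_distrib_left[symmetric] sum_distrib_right[symmetric] insert(3)
    by (simp add: algebra_simps)
  also have "\<dots> = (1 - p) ^ card (insert x I \<inter> J)"
    using insert(1,2) by (auto simp: Int_insert_left)
  finally show ?case .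
qed

lemma sum_subset_weight: "finite I \<Longrightarrow> (\<Sum>G\<in>Pow I. subset_weight p I G) = 1"
  using prob_avoid[of I p "{}"] by simp

text \<open>Since \<open>\<phi>\<close> ignores whether \<open>x\<close> is selected, the
  expectation factors into the mean payoff at \<open>x\<close> and the mean of \<open>\<phi>\<close>
  over the remaining elements.\<close>

lemma expectation_indep:
  fixes \<phi> :: "'a set \<Rightarrow> real"
  assumes "finite I" "x \<in> I" and \<phi>: "\<And>G. G \<subseteq> I - {x} \<Longrightarrow> \<phi> (insert x G) = \<phi> G"
  shows "(\<Sum>G\<in>Pow I. subset_weight p I G * (\<phi> G * (if x \<in> G then y else z)))
    = (p * y + (1 - p) * z) * (\<Sum>G\<in>Pow (I - {x}). subset_weight p (I - {x}) G * \<phi> G)"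
proof -
  have I: "I = insert x (I - {x})" using assms(2) by auto
  have fin: "finite (I - {x})" and nin: "x \<notin> I - {x}" using assms(1) by auto
  have "(\<Sum>G\<in>Pow (insert x (I - {x})). subset_weight p (insert x (I - {x})) G *
          (\<phi> G * (if x \<in> G then y else z)))
    = (\<Sum>G\<in>Pow (I - {x}). (p * y + (1 - p) * z) * (subset_weight p (I - {x}) G * \<phi> G))"
    unfolding sum_Pow_insert[OF fin nin]
  proof (intro sum.cong refl)
    fix G assume "G \<in> Pow (I - {x})"
    then have G: "G \<subseteq> I - {x}" "x \<notin> G" by auto
    show "subset_weight p (insert x (I - {x})) G * (\<phi> G * (if x \<in> G then y else z)) +
        subset_weight p (insert x (I - {x})) (insert x G) *
          (\<phi> (insert x G) * (if x \<in> insert x G then y else z))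
      = (p * y + (1 - p) * z) * (subset_weight p (I - {x}) G * \<phi> G)"
      using G(2) unfolding subset_weight_insert[OF fin nin G(1)] \<phi>[OF G(1)]
      by (simp add: algebra_simps)
  qed
  then show ?thesis using I by (simp add: sum_distrib_left)
qed

section \<open>The online throughput\<close>

text \<open>Leaves truncated subtraction for the reals; it shows that the denominator of the
  probability \<open>p\<close> is at least 1.\<close>

lemma work_le_real:
  fixes V W w :: nat
  assumes "w \<le> V * (W - 1)" "2 \<le> W"
  shows "real w \<le> real V * (real W - 1)"
proof -
  have "real w \<le> real (V * (W - 1))" using assms(1) by (rule of_nat_mono)
  then show ?thesis using assms(2) by (simp add: of_nat_diff)
qed

lemma online_le:
  fixes V W W\<^sub>0 M B n :: nat
  defines "I \<equiv> {..<n} \<times> {..<M}"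
    and "\<sigma> \<equiv> two_kinds (Packet W\<^sub>0 V False) (Packet W 1 False) M n"
    and "p \<equiv> 1 / (real V * (real W - 1) + 1 - real W\<^sub>0)"
  assumes V: "1 \<le> V" and W: "2 \<le> W" and W0: "1 \<le> W\<^sub>0" and le: "W\<^sub>0 \<le> V * (W - 1)"
    and feas: "\<And>G. feasible (enat B) (\<sigma> G) (run A (\<sigma> G))"
  shows "(\<Sum>G\<in>Pow I. subset_weight p I G * throughput (\<sigma> G) (run A (\<sigma> G)))
    \<le> real n / (real W - 1) + real B * real V"
proof -
  let ?a = "Packet W\<^sub>0 V False" and ?b = "Packet W 1 False"
  let ?w = "subset_weight p I"
  define X where "X G x = progress (run A (\<sigma> G)) n x" for G x
  define \<phi> where "\<phi> x G = (of_bool (X G x \<noteq> 0) :: real)" for x G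
  define y where "y = real V * (real W - 1) - real W\<^sub>0"
  have y: "0 \<le> y"
    unfolding y_def using work_le_real[OF le W] by simp
  have p: "p = 1 / (y + 1)" by (simp add: p_def y_def)
  then have p01: "0 \<le> p" "p \<le> 1" using y by auto
  have finI: "finite I" by (simp add: I_def)
  text \<open>Opening a packet is a bet with outcome y or -1, which is fair for this p.\<close>
  have bound: "throughput (\<sigma> G) (run A (\<sigma> G)) \<le> real B * real V +
      (real n + (\<Sum>x\<in>I. \<phi> x G * (if x \<in> G then y else -1))) / (real W - 1)" for G
  proof -
    have ids: "(\<Union>t. arrival_ids (\<sigma> G) t) = I"
      unfolding \<sigma>_def I_def by (rule UN_arrival_ids_two_kinds)
    have pk: "packet_of (\<sigma> G) x = (if x \<in> G then ?a else ?b)" if "x \<in> I" for x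
      using that unfolding \<sigma>_def I_def by (rule packet_of_two_kinds)
    have len: "length (\<sigma> G) = n" by (simp add: \<sigma>_def)
    let ?g = "\<lambda>x. if work (packet_of (\<sigma> G) x) \<le> X G x then real (profit (packet_of (\<sigma> G) x)) else 0"
    have "throughput (\<sigma> G) (run A (\<sigma> G)) \<le> real B * real V + (\<Sum>x\<in>I. ?g x)"
      unfolding X_def using throughput_le[OF feas[of G], of V] V pk unfolding ids len by auto
    also have "(\<Sum>x\<in>I. ?g x) \<le>
        (\<Sum>x\<in>I. (real (X G x) + \<phi> x G * (if x \<in> G then y else -1)) / (real W - 1))"
    proof (rule sum_mono)
      fix x assume x: "x \<in> I"
      \<comment> \<open>An unopened packet gives 0 on both sides, as works are positive. When
        completed, a good packet gives V (W - 1) = \<open>W\<^sub>0\<close> + y, at most X + y, and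
        a bad one W - 1, at most X - 1. When opened but incomplete, X + y and X - 1 are still
        nonnegative.\<close>
      have "?g x * (real W - 1) \<le> real (X G x) + \<phi> x G * (if x \<in> G then y else -1)"
      proof (cases "X G x = 0")
        case True
        then show ?thesis using pk[OF x] W W0 by (simp add: \<phi>_def)
      next
        case False
        then show ?thesis using pk[OF x] W y by (auto simp: \<phi>_def y_def)
      qed
      then show "?g x \<le> (real (X G x) + \<phi> x G * (if x \<in> G then y else -1)) / (real W - 1)"
        using W by (simp add: pos_le_divide_eq)
    qed
    also have "\<dots> = (real (\<Sum>x\<in>I. X G x) + (\<Sum>x\<in>I. \<phi> x G * (if x \<in> G then y else -1))) / (real W - 1)"
      by (simp add: sum_divide_distrib[symmetric] sum.distrib)
    also have "\<dots> \<le> (real n + (\<Sum>x\<in>I. \<phi> x G * (if x \<in> G then y else -1))) / (real W - 1)"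
      using sum_progress_le[OF finI, of "run A (\<sigma> G)" n] W unfolding X_def[symmetric]
      by (intro divide_right_mono add_right_mono) (simp_all del: of_nat_sum)
    finally show ?thesis by simp
  qed
  have fair: "(\<Sum>G\<in>Pow I. ?w G * (\<phi> x G * (if x \<in> G then y else -1))) = 0" if x: "x \<in> I" for x
  proof -
    \<comment> \<open>The two instances agree off \<open>x\<close>, so whether \<open>x\<close> is
      opened does not depend on its kind.\<close>
    have "\<phi> x (insert x G) = \<phi> x G" for G
      using opened_indep[of ?a ?b "enat B" M n "insert x G" A G x n] feas
      unfolding \<phi>_def X_def \<sigma>_def by simp
    moreover have "p * y + (1 - p) * (-1) = 0"
      using y unfolding p by (simp add: field_simps)
    ultimately show ?thesis
      using expectation_indep[OF finI x, of "\<phi> x" p y "-1"] by simp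
  qed
  have "(\<Sum>G\<in>Pow I. ?w G * throughput (\<sigma> G) (run A (\<sigma> G)))
    \<le> (\<Sum>G\<in>Pow I. ?w G * (real B * real V +
        (real n + (\<Sum>x\<in>I. \<phi> x G * (if x \<in> G then y else -1))) / (real W - 1)))"
    using bound subset_weight_nonneg[OF p01] by (intro sum_mono mult_left_mono) auto
  also have "\<dots> = (\<Sum>G\<in>Pow I. ?w G * (real B * real V + real n / (real W - 1)) +
        (\<Sum>x\<in>I. ?w G * (\<phi> x G * (if x \<in> G then y else -1))) / (real W - 1))"
    by (intro sum.cong refl) (simp add: add_divide_distrib distrib_left sum_distrib_left)
  \<comment> \<open>Weights sum to 1, and swapping the sums isolates the expected bet on each single
    packet.\<close>
  also have "\<dots> = (real B * real V + real n / (real W - 1)) +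
      (\<Sum>x\<in>I. \<Sum>G\<in>Pow I. ?w G * (\<phi> x G * (if x \<in> G then y else -1))) / (real W - 1)"
    unfolding sum.distrib sum_distrib_right[symmetric] sum_divide_distrib[symmetric]
      sum_subset_weight[OF finI] by (subst sum.swap) simp
  also have "\<dots> = real n / (real W - 1) + real B * real V"
    by (simp only: sum.cong[OF refl fair]) simp
  finally show ?thesis .
qed

section \<open>The offline throughput\<close>

text \<open>\<open>K G\<close> collects the blocks of \<open>2 * L\<close> cycles with a packet of
  kind \<open>a\<close> arriving in the first half. One such packet per block, processed from its
  arrival on, is finished within the block, so the chosen packets never compete for the
  slot.\<close>

lemma offline_ge:
  fixes L M k :: nat and C :: enat
  defines "n \<equiv> 2 * L * k"
  defines "K \<equiv> \<lambda>G. {j \<in> {..<k}. G \<inter> {2 * L * j..<2 * L * j + L} \<times> {..<M} \<noteq> {}}"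
  assumes L: "1 \<le> L" "work a = L" and C: "1 \<le> C"
  shows "\<exists>S. feasible C (two_kinds a b M n G) S \<and>
    real (card (K G)) * real (profit a) \<le> throughput (two_kinds a b M n G) S"
proof -
  let ?\<sigma> = "two_kinds a b M n G"
  have "\<forall>j\<in>K G. \<exists>x. x \<in> G \<and> fst x \<in> {2 * L * j..<2 * L * j + L} \<and> snd x < M"
    unfolding K_def by fastforce
  then obtain P where P: "\<And>j. j \<in> K G \<Longrightarrow> P j \<in> G"
      "\<And>j. j \<in> K G \<Longrightarrow> 2 * L * j \<le> fst (P j)" "\<And>j. j \<in> K G \<Longrightarrow> fst (P j) < 2 * L * j + L"
      "\<And>j. j \<in> K G \<Longrightarrow> snd (P j) < M"
    unfolding atLeastLessThan_iff by metis
  \<comment> \<open>The packet \<open>P j\<close> chosen for block \<open>j\<close> is in service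
    during cycle \<open>t\<close>.\<close>
  define act where "act j t \<longleftrightarrow> j \<in> K G \<and> fst (P j) \<le> t \<and> t < fst (P j) + L" for j t
  define S :: schedule where "S t = (let j = t div (2 * L) in
    if act j t then ({P j}, Some (P j)) else ({}, None))" for t
  \<comment> \<open>Arrival before the middle of the block plus \<open>L\<close> cycles of service
    ends no later than the block, so \<open>t\<close> determines \<open>j\<close>.\<close>
  have block: "t div (2 * L) = j" if "act j t" for j t
  proof -
    have "j * (2 * L) \<le> t" "t < Suc j * (2 * L)"
      using that P(2,3)[of j] unfolding act_def by (auto simp: algebra_simps)
    then show ?thesis using L by (intro div_nat_eqI) (auto simp: mult.commute)
  qed
  have actP: "act j (fst (P j))" if "j \<in> K G" for j
    using that L by (simp add: act_def)
  have inj: "inj_on P (K G)"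
    by (rule inj_onI) (metis actP block)
  \<comment> \<open>Trades the division in the definition of \<open>S\<close> for an existential
    over blocks.\<close>
  have act_ex: "(\<exists>j. act j t \<and> p = P j) \<longleftrightarrow> act (t div (2 * L)) t \<and> p = P (t div (2 * L))" for p t
    using block by metis
  have buf: "p \<in> buffer S t \<longleftrightarrow> (\<exists>j. act j t \<and> p = P j)" for p t
    unfolding act_ex by (simp add: S_def Let_def)
  have proc: "processed S t = Some p \<longleftrightarrow> (\<exists>j. act j t \<and> p = P j)" for p t
    unfolding act_ex by (auto simp: S_def Let_def)
  have PI: "P j \<in> {..<n} \<times> {..<M}" if "j \<in> K G" for j
  proof -
    have "j + 1 \<le> k" using that by (simp add: K_def)
    then have "2 * L * (j + 1) \<le> n" unfolding n_def by (rule mult_le_mono2)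
    then show ?thesis using P(3,4)[OF that] by (auto simp: mem_Times_iff algebra_simps)
  qed
  have pk: "packet_of ?\<sigma> (P j) = a" if "j \<in> K G" for j
    using packet_of_two_kinds[OF PI[OF that]] P(1)[OF that] by simp
  \<comment> \<open>The bound on \<open>t\<close> includes the cycle after the last service, where
    the progress is exactly \<open>L\<close>.\<close>
  have prog: "progress S t (P j) = t - fst (P j)" if "j \<in> K G" "t \<le> fst (P j) + L" for j t
  proof -
    have "{s. s < t \<and> processed S s = Some (P j)} = {fst (P j)..<t}"
    proof (intro set_eqI iffI)
      fix s assume "s \<in> {s. s < t \<and> processed S s = Some (P j)}"
      then obtain i where "s < t" "act i s" "P j = P i" unfolding proc by auto
      then show "s \<in> {fst (P j)..<t}" by (auto simp: act_def)
    next
      fix s assume "s \<in> {fst (P j)..<t}"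
      then have "s < t" "act j s" using that by (auto simp: act_def)
      then show "s \<in> {s. s < t \<and> processed S s = Some (P j)}" unfolding proc by auto
    qed
    then show ?thesis by (simp add: progress_def)
  qed
  have "feasible C ?\<sigma> S"
    unfolding feasible_def
  proof (intro allI conjI impI)
    fix t
    show "buffer S t \<subseteq> retained ?\<sigma> S t \<union> arrival_ids ?\<sigma> t"
    proof
      fix p assume "p \<in> buffer S t"
      then obtain j where j: "act j t" "p = P j" unfolding buf by blast
      then have jK: "j \<in> K G" and ge: "fst (P j) \<le> t" and lt: "t < fst (P j) + L"
        by (auto simp: act_def)
      show "p \<in> retained ?\<sigma> S t \<union> arrival_ids ?\<sigma> t"
      proof (cases "fst (P j) = t")
        case True
        then show ?thesis using PI[OF jK] j(2) by (auto simp: arrival_ids_two_kinds mem_Times_iff)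
      next
        case False
        \<comment> \<open>After its arrival cycle the packet must be retained: it was in service one
          cycle earlier and has fewer than \<open>L\<close> cycles so far.\<close>
        then obtain t' where t': "t = Suc t'" "fst (P j) \<le> t'" using ge by (cases t) auto
        then have "act j t'" using jK lt by (simp add: act_def)
        then have "p \<in> buffer S t'" using j(2) buf by blast
        moreover have "progress S t p < work (packet_of ?\<sigma> p)"
          using prog[OF jK, of t] lt ge L pk[OF jK] j(2) by simp
        ultimately show ?thesis using t' by simp
      qed
    qed
    have "card (buffer S t) \<le> 1" unfolding S_def Let_def by auto
    then have "enat (card (buffer S t)) \<le> 1" by (simp add: one_enat_def)
    then show "enat (card (buffer S t)) \<le> C" using C by (rule order.trans)
    show "p \<in> buffer S t" if "processed S t = Some p" for p
      using that unfolding buf proc .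
  qed
  moreover have "real (card (K G)) * real (profit a) \<le> throughput ?\<sigma> S"
  proof -
    have sub: "P ` K G \<subseteq> transmitted ?\<sigma> S"
    proof
      fix p assume "p \<in> P ` K G"
      then obtain j where j: "j \<in> K G" "p = P j" by blast
      \<comment> \<open>The last of the \<open>L\<close> service cycles; the packet leaves in the
        next transmission step.\<close>
      let ?t = "fst (P j) + (L - 1)"
      have "act j ?t" using j L by (auto simp: act_def)
      then have "p \<in> buffer S ?t" using j(2) buf by blast
      moreover have "progress S (Suc ?t) p = L"
        using prog[OF j(1), of "Suc ?t"] L j(2) by simp
      then have "p \<notin> retained ?\<sigma> S (Suc ?t)"
        using pk[OF j(1)] L(2) j(2) unfolding retained.simps by simp
      ultimately show "p \<in> transmitted ?\<sigma> S" unfolding transmitted_def by blast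
    qed
    have fin: "finite (transmitted ?\<sigma> S)"
      using transmitted_subset[OF \<open>feasible C ?\<sigma> S\<close>] finite_arrival_ids by (rule finite_subset)
    have "real (card (K G)) * real (profit a) = (\<Sum>p\<in>P ` K G. real (profit (packet_of ?\<sigma> p)))"
      using pk by (simp add: sum.reindex[OF inj])
    also have "\<dots> \<le> throughput ?\<sigma> S"
      unfolding throughput_def using fin sub by (intro sum_mono2) auto
    finally show ?thesis .
  qed
  ultimately show ?thesis by blast
qed

text \<open>By linearity of expectation: the first half of a block holds \<open>M * L\<close>
  packets, and all of them are bad with probability (1 - p) to the power
  \<open>M * L\<close>.\<close>

lemma expected_blocks:
  fixes L M k :: nat
  defines "I \<equiv> {..<2 * L * k} \<times> {..<M}"
  defines "K \<equiv> \<lambda>G. {j \<in> {..<k}. G \<inter> {2 * L * j..<2 * L * j + L} \<times> {..<M} \<noteq> {}}"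
  shows "(\<Sum>G\<in>Pow I. subset_weight p I G * real (card (K G))) = real k * (1 - (1 - p) ^ (M * L))"
proof -
  let ?J = "\<lambda>j. {2 * L * j..<2 * L * j + L} \<times> {..<M}"
  have finI: "finite I" by (simp add: I_def)
  have *: "(\<Sum>G\<in>Pow I. subset_weight p I G * of_bool (G \<inter> ?J j \<noteq> {})) = 1 - (1 - p) ^ (M * L)"
    if "j < k" for j
  proof -
    have "2 * L * (j + 1) \<le> 2 * L * k" using that by (intro mult_le_mono2) simp
    then have "?J j \<subseteq> I" by (auto simp: I_def)
    then have card: "card (I \<inter> ?J j) = M * L" by (simp add: Int_absorb1 card_cartesian_product)
    have "(\<Sum>G\<in>Pow I. subset_weight p I G * of_bool (G \<inter> ?J j \<noteq> {})) =
        (\<Sum>G\<in>Pow I. subset_weight p I G - subset_weight p I G * of_bool (G \<inter> ?J j = {}))"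
      by (intro sum.cong) auto
    then show ?thesis
      using card by (simp add: sum_subtractf sum_subset_weight[OF finI] prob_avoid[OF finI])
  qed
  have cardK: "real (card (K G)) = (\<Sum>j<k. of_bool (G \<inter> ?J j \<noteq> {}))" for G
    unfolding K_def by (simp add: of_bool_def sum.inter_filter[symmetric])
  show ?thesis
    unfolding cardK sum_distrib_left by (subst sum.swap) (simp add: *)
qed

section \<open>The lower bound\<close>

text \<open>Averages the competitiveness inequality over the random instance with \<open>k\<close>
  blocks and exchanges this average with the one over seeds. Using \<open>max c 0\<close> gives a
  nonnegative factor before anything is known about the sign of \<open>c\<close>.\<close>

lemma competitive_averaged:
  fixes V M W W\<^sub>0 B k :: nat
  defines "p \<equiv> 1 / (real V * (real W - 1) + 1 - real W\<^sub>0)"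
  assumes V: "1 \<le> V" and W: "2 \<le> W" and W0: "1 \<le> W\<^sub>0" "W\<^sub>0 \<le> W" and le: "W\<^sub>0 \<le> V * (W - 1)"
    and C: "1 \<le> C"
    and alg: "randomized_online_algorithm (traffic V W W\<^sub>0 M) B R A"
    and comp: "competitive (traffic V W W\<^sub>0 M) C R A c"
  shows "real k * (1 - (1 - p) ^ (M * W\<^sub>0)) * real V \<le>
    max c 0 * (real (2 * W\<^sub>0 * k) / (real W - 1) + real B * real V)"
proof -
  let ?a = "Packet W\<^sub>0 V False" and ?b = "Packet W 1 False"
  define n where "n = 2 * W\<^sub>0 * k"
  define I where "I = {..<n} \<times> {..<M}"
  define \<sigma> where "\<sigma> = two_kinds ?a ?b M n"
  define K where "K G = {j \<in> {..<k}. G \<inter> {2 * W\<^sub>0 * j..<2 * W\<^sub>0 * j + W\<^sub>0} \<times> {..<M} \<noteq> {}}" for G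
  define T where "T G \<omega> = throughput (\<sigma> G) (run (A \<omega>) (\<sigma> G))" for G \<omega>
  let ?w = "subset_weight p I"
  interpret prob_space R
    using alg unfolding randomized_online_algorithm_def by blast
  have tr: "\<sigma> G \<in> traffic V W W\<^sub>0 M" for G
    unfolding \<sigma>_def using V W W0 by (intro two_kinds_in_traffic) auto
  have feas: "feasible (enat B) (\<sigma> G) (run (A \<omega>) (\<sigma> G))" if "\<omega> \<in> space R" for G \<omega>
    using alg that tr unfolding randomized_online_algorithm_def online_algorithm_def by blast
  have meas: "T G \<in> borel_measurable R" for G
    using alg tr unfolding randomized_online_algorithm_def T_def by blast
  have p01: "0 \<le> p" "p \<le> 1" using work_le_real[OF le W] by (auto simp: p_def)
  note w = subset_weight_nonneg[OF p01, of I]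
  have T0: "0 \<le> T G \<omega>" for G \<omega>
    unfolding T_def throughput_def by (simp add: sum_nonneg)
  \<comment> \<open>Bounded by the total value of all arrivals; integrability allows the exchange of
    sum and integral below.\<close>
  have int: "integrable R (T G)" for G
  proof (rule integrable_const_bound)
    show "AE \<omega> in R. norm (T G \<omega>) \<le> real (card I) * real V"
    proof (rule AE_I2)
      fix \<omega> assume "\<omega> \<in> space R"
      then have sub: "transmitted (\<sigma> G) (run (A \<omega>) (\<sigma> G)) \<subseteq> I"
        using transmitted_subset[OF feas] unfolding \<sigma>_def I_def UN_arrival_ids_two_kinds by blast
      have "T G \<omega> \<le> (\<Sum>x\<in>I. real (profit (packet_of (\<sigma> G) x)))"
        unfolding T_def throughput_def using sub by (intro sum_mono2) (auto simp: I_def)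
      also have "\<dots> \<le> real (card I) * real V"
        using V by (intro sum_bounded_above) (auto simp: I_def \<sigma>_def packet_of_two_kinds)
      finally show "norm (T G \<omega>) \<le> real (card I) * real V" using T0 by simp
    qed
  qed (rule meas)
  have E0: "0 \<le> expected_throughput R A (\<sigma> G)" for G
    unfolding expected_throughput_def T_def[symmetric] using T0 by simp
  have off: "real (card (K G)) * real V \<le> max c 0 * expected_throughput R A (\<sigma> G)" for G
  proof -
    obtain S where S: "feasible C (\<sigma> G) S" "real (card (K G)) * real V \<le> throughput (\<sigma> G) S"
      using offline_ge[of W\<^sub>0 ?a C ?b M k G] W0 C unfolding \<sigma>_def n_def K_def by auto
    note S(2)
    also have "throughput (\<sigma> G) S \<le> c * expected_throughput R A (\<sigma> G)"
      using comp tr S(1) unfolding competitive_def by blast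
    also have "\<dots> \<le> max c 0 * expected_throughput R A (\<sigma> G)"
      using E0 by (intro mult_right_mono) auto
    finally show ?thesis .
  qed
  have "real k * (1 - (1 - p) ^ (M * W\<^sub>0)) * real V = (\<Sum>G\<in>Pow I. ?w G * (real (card (K G)) * real V))"
    unfolding expected_blocks[symmetric] K_def I_def n_def
    by (simp add: sum_distrib_right mult.assoc)
  also have "\<dots> \<le> (\<Sum>G\<in>Pow I. ?w G * (max c 0 * expected_throughput R A (\<sigma> G)))"
    using off w by (intro sum_mono mult_left_mono) auto
  also have "\<dots> = max c 0 * (\<Sum>G\<in>Pow I. ?w G * (\<integral>\<omega>. T G \<omega> \<partial>R))"
    by (simp add: expected_throughput_def T_def sum_distrib_left mult_ac)
  \<comment> \<open>With the seed fixed inside the integral, the algorithm is deterministic and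
    \<open>online_le\<close> applies pointwise.\<close>
  also have "(\<Sum>G\<in>Pow I. ?w G * (\<integral>\<omega>. T G \<omega> \<partial>R)) = (\<integral>\<omega>. (\<Sum>G\<in>Pow I. ?w G * T G \<omega>) \<partial>R)"
    using int by (subst Bochner_Integration.integral_sum) auto
  also have "max c 0 * \<dots> \<le> max c 0 * (real n / (real W - 1) + real B * real V)"
  proof (intro mult_left_mono integral_le_const AE_I2)
    show "integrable R (\<lambda>\<omega>. \<Sum>G\<in>Pow I. ?w G * T G \<omega>)" using int by auto
    fix \<omega> assume "\<omega> \<in> space R"
    then show "(\<Sum>G\<in>Pow I. ?w G * T G \<omega>) \<le> real n / (real W - 1) + real B * real V"
      using online_le[OF V W W0(1) le, of B M n "A \<omega>"] feas
      unfolding T_def \<sigma>_def I_def p_def by blast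
  qed simp
  finally show ?thesis unfolding n_def .
qed

text \<open>Archimedean: the constant \<open>z\<close> is negligible against \<open>k\<close> for
  large \<open>k\<close>.\<close>

lemma le_if_all_multiples_le:
  fixes x y z :: real
  assumes "\<And>k::nat. real k * x \<le> real k * y + z"
  shows "x \<le> y"
proof (rule ccontr)
  assume "\<not> x \<le> y"
  then obtain k :: nat where "z < real k * (x - y)"
    using reals_Archimedean3[of "x - y"] by auto
  then show False using assms[of k] by (simp add: algebra_simps)
qed

theorem theorem1:
  fixes V M W W\<^sub>0 B :: nat and C :: enat
    and R :: "'r measure" and A :: "'r \<Rightarrow> algorithm"
  assumes "V \<ge> 1" and "M \<ge> 1" and "W \<ge> 2" and "1 \<le> W\<^sub>0" and "W\<^sub>0 \<le> W"
    and "\<not> (V = 1 \<and> W = W\<^sub>0)"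
    and "B \<ge> 2" and "C \<ge> 1"
    and "randomized_online_algorithm (traffic V W W\<^sub>0 M) B R A"
  shows "competitive_ratio (traffic V W W\<^sub>0 M) C R A \<ge>
    ereal (real V * (real W - 1) / (2 * real W\<^sub>0) *
      (1 - (1 - 1 / (real V * (real W - 1) + 1 - real W\<^sub>0)) ^ (M * W\<^sub>0)))"
proof -
  define p where "p = 1 / (real V * (real W - 1) + 1 - real W\<^sub>0)"
  define q where "q = 1 - (1 - p) ^ (M * W\<^sub>0)"
  \<comment> \<open>Non-uniformity enters here: V = 1 forces \<open>W\<^sub>0\<close> < W, while for
    V at least 2 the bound 2 (W - 1) is at least W.\<close>
  have le: "W\<^sub>0 \<le> V * (W - 1)"
  proof (cases "V = 1")
    case False
    then have "2 * (W - 1) \<le> V * (W - 1)" using assms by (intro mult_le_mono1) simp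
    then show ?thesis using assms by linarith
  qed (use assms in auto)
  have p: "0 < p" "p \<le> 1" using work_le_real[OF le assms(3)] by (auto simp: p_def)
  have "(1 - p) ^ (M * W\<^sub>0) < 1"
    using p assms by (auto simp: power_less_one_iff)
  then have q: "0 < q" by (simp add: q_def)
  have "real V * (real W - 1) / (2 * real W\<^sub>0) * q \<le> c"
    if comp: "competitive (traffic V W W\<^sub>0 M) C R A c" for c
  proof -
    \<comment> \<open>Online gain and offline gain both grow linearly in the number of blocks; the
      buffer term stays constant and disappears in the limit.\<close>
    have "real k * (q * real V) \<le> real k * (max c 0 * (2 * real W\<^sub>0 / (real W - 1))) +
        max c 0 * (real B * real V)" for k
      using competitive_averaged[OF assms(1,3,4,5) le assms(8,9) comp, of k]
      unfolding q_def p_def by (simp add: algebra_simps)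
    then have "q * real V \<le> max c 0 * (2 * real W\<^sub>0 / (real W - 1))"
      by (rule le_if_all_multiples_le)
    then have "real V * (real W - 1) / (2 * real W\<^sub>0) * q \<le> max c 0"
      using assms by (simp add: field_simps)
    \<comment> \<open>A positive lower bound on \<open>max c 0\<close> forces \<open>max c 0\<close>
      = c.\<close>
    moreover have "0 < real V * (real W - 1) / (2 * real W\<^sub>0) * q"
      using assms q by simp
    ultimately show ?thesis by linarith
  qed
  then show ?thesis
    unfolding competitive_ratio_def q_def p_def by (intro Inf_greatest) auto
qed

end
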